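(* Fix an admissible set $A$ of addition chains. Then: (1) If $\alpha$ is a value of $\delta^A$ and $S(\alpha):=\{m\ge1:\delta^A(m)=\alpha\}$, then there is a unique positive integer $n$ such that $S(\alpha)$ is either of the form $\{n\cdot 2^k: 0\le k\le K\}$ for some finite $K\ge0$, or of the form $\{n\cdot 2^k: k\ge 0\}$. (This $n$ is called the leader of $S(\alpha)$.) (2) The set $S(\alpha)$ is infinite if and only if $\alpha$ is the smallest value among all the defects $\delta^A(2^k n)$, $k\ge 0$, where $n$ is the leader of $S(\alpha)$. (3) For a fixed odd positive integer $n$, the sequence $(\delta^A(n\cdot 2^k))_{k\ge0}$ is non-increasing, takes only finitely many values, all differing from each other by integers, and its smallest value $\alpha$ has the property that whenever $\delta^A(m)=\alpha$ and $k\ge 0$, we have $\ell^A(m\cdot 2^k)=\ell^A(m)+k$.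
   Context: An addition chain for a positive integer $n$ is a sequence $(a_0,\ldots,a_r)$ with $a_0=1$, $a_r=n$, and for every $1\le k\le r$ there exist $0\le i,j<k$ with $a_k=a_i+a_j$; $r$ is its length. For a set $A$ of addition chains, $\ell^A(n)$ is the least length of an addition chain for $n$ belonging to $A$. $\nu_2(n)$ is the number of $1$'s in the binary expansion of $n$. A set $A$ of addition chains is admissible if (i) for every $n\ge1$, $\ell^A(n)$ is defined and $\ell^A(n)\le\lfloor\log_2 n\rfloor+\nu_2(n)-1$, and (ii) for every $n\ge 1$, $\ell^A(2n)\le \ell^A(n)+1$. The $A$-defect is $\delta^A(n)=\ell^A(n)-\log_2 n$. *)

theory Defs
  imports Complex_Main
begin

text \<open>A chain $(a_0,\ldots,a_r)$ is the list of its $r+1$ entries, so its length in the sense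
  of addition chains is one less than its length as a list.\<close>

definition is_addition_chain_for :: "nat list \<Rightarrow> nat \<Rightarrow> bool" where
  "is_addition_chain_for c n \<longleftrightarrow>
     c \<noteq> [] \<and> c ! 0 = 1 \<and> last c = n \<and>
     (\<forall>k. 1 \<le> k \<and> k < length c \<longrightarrow> (\<exists>i<k. \<exists>j<k. c ! k = c ! i + c ! j))"

definition is_addition_chain :: "nat list \<Rightarrow> bool" where
  "is_addition_chain c \<longleftrightarrow> (\<exists>n\<ge>1. is_addition_chain_for c n)"

definition chain_length :: "nat list \<Rightarrow> nat" where
  "chain_length c = length c - 1"

definition ell_defined :: "nat list set \<Rightarrow> nat \<Rightarrow> bool" where
  "ell_defined A n \<longleftrightarrow> (\<exists>c\<in>A. is_addition_chain_for c n)"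

text \<open>Meaningful only when \<open>ell_defined A n\<close> holds.\<close>

definition ell :: "nat list set \<Rightarrow> nat \<Rightarrow> nat" where
  "ell A n = (LEAST r. \<exists>c\<in>A. is_addition_chain_for c n \<and> chain_length c = r)"

definition nu2 :: "nat \<Rightarrow> nat" where
  "nu2 n = card {i. bit n i}"

definition admissible :: "nat list set \<Rightarrow> bool" where
  "admissible A \<longleftrightarrow>
     (\<forall>c\<in>A. is_addition_chain c) \<and>
     (\<forall>n\<ge>1. ell_defined A n \<and> int (ell A n) \<le> \<lfloor>log 2 (real n)\<rfloor> + int (nu2 n) - 1) \<and>
     (\<forall>n\<ge>1. ell A (2 * n) \<le> ell A n + 1)"

definition defect :: "nat list set \<Rightarrow> nat \<Rightarrow> real" where
  "defect A n = real (ell A n) - log 2 (real n)"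

definition defect_values :: "nat list set \<Rightarrow> real set" where
  "defect_values A = defect A ` {1..}"

definition level_set :: "nat list set \<Rightarrow> real \<Rightarrow> nat set" where
  "level_set A \<alpha> = {m. m \<ge> 1 \<and> defect A m = \<alpha>}"

text \<open>A predicate rather than a function: that it determines \<open>n\<close> is part of what is claimed
  about level sets.\<close>

definition is_leader :: "nat list set \<Rightarrow> real \<Rightarrow> nat \<Rightarrow> bool" where
  "is_leader A \<alpha> n \<longleftrightarrow>
     n \<ge> 1 \<and>
     ((\<exists>K. level_set A \<alpha> = {n * 2 ^ k | k. k \<le> K}) \<or>
      level_set A \<alpha> = {n * 2 ^ k | k. True})"

definition is_smallest :: "real \<Rightarrow> real set \<Rightarrow> bool" where
  "is_smallest x X \<longleftrightarrow> x \<in> X \<and> (\<forall>y\<in>X. x \<le> y)"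

end

theory Submission
  imports Defs
begin

text \<open>Condition (ii) says that doubling never increases the defect, and the defect is
  nonnegative because the \<open>k\<close>-th entry of an addition chain is at most \<open>2 ^ k\<close>. As
  \<open>\<delta>(2 ^ k n) - \<delta>(n)\<close> is an integer, the defects along \<open>n, 2n, 4n, \<dots>\<close> form a non-increasing
  sequence that drops by integers only finitely often. Two numbers of equal defect have integral
  difference of base-2 logarithms, so their ratio is a power of two; hence a level set lies in a
  single such sequence, starting at its least element, and is an initial segment of it by
  monotonicity.\<close>

section \<open>Growth of addition chains and nonnegativity of the defect\<close>

lemma addition_chain_nth_le:
  assumes "is_addition_chain_for c n" "k < length c"
  shows "c ! k \<le> 2 ^ k"
  using assms(2)
proof (induction k rule: less_induct)
  case (less k)
  show ?case
  proof (cases k)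
    case 0
    then show ?thesis
      using assms(1) by (simp add: is_addition_chain_for_def)
  next
    case (Suc k')
    then obtain i j where ij: "i < k" "j < k" "c ! k = c ! i + c ! j"
      using assms(1) less.prems unfolding is_addition_chain_for_def
      by (metis One_nat_def Suc_leI zero_less_Suc)
    \<comment> \<open>Both summands of \<open>c ! k\<close> have index at most \<open>k'\<close>, so
      their sum is at most twice \<open>2 ^ k'\<close>.\<close>
    have "c ! l \<le> 2 ^ k'" if "l < k" for l
    proof -
      have "c ! l \<le> 2 ^ l"
        using less that by simp
      also have "\<dots> \<le> 2 ^ k'"
        using that Suc by (intro power_increasing) auto
      finally show ?thesis .
    qed
    from this[OF ij(1)] this[OF ij(2)] show ?thesis
      using ij(3) Suc by simp
  qed
qed

lemma le_two_power_chain_length: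
  assumes "is_addition_chain_for c n"
  shows "n \<le> 2 ^ chain_length c"
proof -
  have "c \<noteq> []" "n = c ! chain_length c"
    using assms by (auto simp: is_addition_chain_for_def chain_length_def last_conv_nth)
  then show ?thesis
    using addition_chain_nth_le[OF assms] by (simp add: chain_length_def)
qed

text \<open>Once some chain for \<open>n\<close> lies in \<open>A\<close>, the least length is
  attained by an actual chain, whose growth bound carries over to \<open>ell\<close>.\<close>

lemma le_two_power_ell:
  assumes "ell_defined A n"
  shows "n \<le> 2 ^ ell A n"
proof -
  have "\<exists>r. \<exists>c\<in>A. is_addition_chain_for c n \<and> chain_length c = r"
    using assms by (auto simp: ell_defined_def)
  then have "\<exists>c\<in>A. is_addition_chain_for c n \<and> chain_length c = ell A n"
    unfolding ell_def by (rule LeastI_ex)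
  then show ?thesis
    using le_two_power_chain_length by metis
qed

lemma defect_nonneg:
  assumes "admissible A" "n \<ge> 1"
  shows "defect A n \<ge> 0"
proof -
  have "real n \<le> 2 ^ ell A n"
    using le_two_power_ell[of A n] assms unfolding admissible_def
    by (metis of_nat_le_iff of_nat_numeral of_nat_power)
  then have "log 2 (real n) \<le> real (ell A n)"
    using assms(2) by (subst log_le_iff) (auto simp: powr_realpow)
  then show ?thesis
    by (simp add: defect_def)
qed

section \<open>The defect under repeated doubling\<close>

lemma defect_mult_two_power:
  assumes "n \<ge> 1"
  shows "defect A (n * 2 ^ k) = real (ell A (n * 2 ^ k)) - real k - log 2 (real n)"
  using assms by (simp add: defect_def log_mult)

lemma decseq_defect:
  assumes "admissible A" "n \<ge> 1"
  shows "decseq (\<lambda>k. defect A (n * 2 ^ k))"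
proof (rule decseq_SucI)
  fix k
  have "ell A (2 * (n * 2 ^ k)) \<le> ell A (n * 2 ^ k) + 1"
    using assms by (simp add: admissible_def)
  then have "real (ell A (n * 2 ^ Suc k)) \<le> real (ell A (n * 2 ^ k)) + 1"
    by (simp add: mult.left_commute)
  then show "defect A (n * 2 ^ Suc k) \<le> defect A (n * 2 ^ k)"
    unfolding defect_mult_two_power[OF assms(2)] by simp
qed

lemma defect_diff_Ints:
  assumes "n \<ge> 1"
  shows "defect A (n * 2 ^ i) - defect A (n * 2 ^ j) \<in> \<int>"
proof -
  have "defect A (n * 2 ^ i) - defect A (n * 2 ^ j) =
      of_int (int (ell A (n * 2 ^ i)) - int i - (int (ell A (n * 2 ^ j)) - int j))"
    unfolding defect_mult_two_power[OF assms] by simp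
  then show ?thesis
    by (metis Ints_of_int)
qed

text \<open>The drop from \<open>f 0\<close> to any later value is an integer, nonnegative by
  monotonicity and at most \<open>f 0 - b\<close> by the lower bound, which leaves finitely many
  choices.\<close>

lemma finite_range_decseq_Ints:
  fixes f :: "nat \<Rightarrow> real"
  assumes "decseq f" "\<And>k. b \<le> f k" "\<And>i j. f i - f j \<in> \<int>"
  shows "finite (range f)"
proof (rule finite_subset)
  show "range f \<subseteq> (\<lambda>z. f 0 - of_int z) ` {0..\<lfloor>f 0 - b\<rfloor>}"
  proof
    fix y assume "y \<in> range f"
    then obtain k where k: "y = f k" by blast
    obtain z where z: "f 0 - f k = of_int z"
      using assms(3) by (metis Ints_cases)
    have "f k \<le> f 0"
      using assms(1) by (simp add: decseq_def)
    then have "0 \<le> z"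
      using z by linarith
    moreover have "z \<le> \<lfloor>f 0 - b\<rfloor>"
      using z assms(2)[of k] by (simp add: le_floor_iff)
    ultimately show "y \<in> (\<lambda>z. f 0 - of_int z) ` {0..\<lfloor>f 0 - b\<rfloor>}"
      using k z by (intro image_eqI[of _ _ z]) auto
  qed
qed simp

section \<open>Numbers of equal defect\<close>

lemma defect_eq_imp_two_power_ratio:
  assumes "n \<ge> 1" "n \<le> m" "defect A m = defect A n"
  shows "\<exists>k. m = n * 2 ^ k"
proof -
  \<comment> \<open>The exponent is the difference of lengths, which equals the difference of
    logarithms. As \<open>n \<le> m\<close>, it is nonnegative and \<open>nat\<close> truncates
    nothing.\<close>
  define k where "k = nat (int (ell A m) - int (ell A n))"
  have "log 2 (real n) \<le> log 2 (real m)"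
    using assms by simp
  moreover have "real (ell A m) - real (ell A n) = log 2 (real m) - log 2 (real n)"
    using assms(3) by (simp add: defect_def)
  ultimately have "log 2 (real m) = log 2 (real n) + real k"
    unfolding k_def by simp
  also have "\<dots> = log 2 (real (n * 2 ^ k))"
    using assms(1) by (simp add: log_mult)
  finally have "real m = real (n * 2 ^ k)"
    using assms by (subst (asm) log_inj[of 2, THEN inj_on_eq_iff]) auto
  then show ?thesis
    using of_nat_eq_iff by blast
qed

text \<open>One of \<open>m\<close> and \<open>n * 2 ^ j\<close> is a power of two times the other.
  If \<open>m\<close> is the smaller one, oddness of \<open>n\<close> means that the quotient only
  removes factors from \<open>2 ^ j\<close>.\<close>

lemma defect_eq_odd_imp_multiple:
  assumes "odd n" "m \<ge> 1" "defect A m = defect A (n * 2 ^ j)"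
  shows "\<exists>i. m = n * 2 ^ i"
proof (cases "n * 2 ^ j \<le> m")
  case True
  then obtain k where "m = n * 2 ^ j * 2 ^ k"
    using defect_eq_imp_two_power_ratio[of "n * 2 ^ j" m A] assms odd_pos by fastforce
  then have "m = n * 2 ^ (j + k)"
    by (simp add: power_add mult.assoc)
  then show ?thesis ..
next
  case False
  then obtain k where k: "n * 2 ^ j = m * 2 ^ k"
    using defect_eq_imp_two_power_ratio[of m "n * 2 ^ j" A] assms by fastforce
  have "k \<le> j"
  proof (rule ccontr)
    assume "\<not> k \<le> j"
    \<comment> \<open>One factor 2 is split off so that cancelling \<open>2 ^ j\<close> makes
      \<open>n\<close> visibly even.\<close>
    then have "2 ^ k = 2 ^ j * (2 * 2 ^ (k - j - 1) :: nat)"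
      by (simp flip: power_add power_Suc)
    then have "n = 2 * (m * 2 ^ (k - j - 1))"
      using k by simp
    then show False
      using assms(1) by simp
  qed
  then have "2 ^ j = (2 ^ (j - k) * 2 ^ k :: nat)"
    by (simp flip: power_add)
  then have "m = n * 2 ^ (j - k)"
    using k by simp
  then show ?thesis ..
qed

section \<open>Leaders of level sets\<close>

lemma is_leader_imp_mem:
  assumes "is_leader A \<alpha> n"
  shows "n \<in> level_set A \<alpha>"
proof -
  have "n * 2 ^ 0 \<in> level_set A \<alpha>"
    using assms unfolding is_leader_def by blast
  then show ?thesis by simp
qed

text \<open>In either form of the level set, a leader belongs to it and divides all its elements, so
  two leaders bound each other.\<close>

lemma is_leader_unique:
  assumes "is_leader A \<alpha> n" "is_leader A \<alpha> n'"
  shows "n = n'"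
proof -
  have le: "x \<le> y" if x: "is_leader A \<alpha> x" and y: "is_leader A \<alpha> y" for x y
  proof -
    obtain k where "y = x * 2 ^ k"
      using is_leader_imp_mem[OF y] x unfolding is_leader_def by blast
    then show ?thesis by simp
  qed
  show ?thesis
    using assms le by (simp add: order_antisym)
qed

lemma is_leader_exists:
  assumes "admissible A" "\<alpha> \<in> defect_values A"
  shows "\<exists>n. is_leader A \<alpha> n"
proof -
  \<comment> \<open>Minimality makes every other element a power of two times \<open>n\<close>, so
    only the set \<open>E\<close> of exponents remains to be determined.\<close>
  define n where "n = (LEAST m. m \<in> level_set A \<alpha>)"
  have "\<exists>m. m \<in> level_set A \<alpha>"
    using assms(2) by (auto simp: defect_values_def level_set_def)
  then have "n \<in> level_set A \<alpha>"
    unfolding n_def by (rule LeastI_ex)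
  then have n: "n \<ge> 1" "defect A n = \<alpha>"
    by (auto simp: level_set_def)
  define E where "E = {k. defect A (n * 2 ^ k) = \<alpha>}"
  have S: "level_set A \<alpha> = {n * 2 ^ k | k. k \<in> E}"
  proof -
    have "\<exists>k. m = n * 2 ^ k" if "m \<in> level_set A \<alpha>" for m
      using defect_eq_imp_two_power_ratio[of n m A] n that Least_le[of "\<lambda>m. m \<in> level_set A \<alpha>" m]
      by (auto simp: level_set_def n_def)
    then show ?thesis
      using n by (fastforce simp: level_set_def E_def)
  qed
  \<comment> \<open>The defect at \<open>j\<close> is squeezed between those at \<open>k\<close> and
    at 0, both equal to \<open>\<alpha>\<close>.\<close>
  have down: "j \<in> E" if "k \<in> E" "j \<le> k" for j k
  proof -
    have "defect A (n * 2 ^ k) \<le> defect A (n * 2 ^ j)"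
         "defect A (n * 2 ^ j) \<le> defect A (n * 2 ^ 0)"
      using decseq_defect[OF assms(1) n(1)] that(2) unfolding decseq_def by blast+
    then show ?thesis
      using that n by (simp add: E_def)
  qed
  \<comment> \<open>A nonempty down-closed set of naturals is an initial segment or everything;
    these are the two forms in \<open>is_leader\<close>.\<close>
  have "(\<exists>K. E = {..K}) \<or> E = UNIV"
  proof (cases "finite E")
    case True
    have "0 \<in> E"
      using n by (simp add: E_def)
    then have "Max E \<in> E"
      using True by (intro Max_in) auto
    then have "E = {..Max E}"
      using down Max_ge[OF True] by blast
    then show ?thesis by blast
  next
    case False
    \<comment> \<open>An infinite \<open>E\<close> is unbounded, so it has an element above
      \<open>k\<close>.\<close>
    then have "k \<in> E" for k
      using down finite_nat_set_iff_bounded_le[of E] by (meson nat_le_linear)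
    then show ?thesis by blast
  qed
  then have "is_leader A \<alpha> n"
    using S n(1) unfolding is_leader_def by auto
  then show ?thesis ..
qed

section \<open>Infinite level sets and smallest defects\<close>

lemma infinite_level_set_iff:
  assumes "admissible A" "is_leader A \<alpha> n"
  shows "infinite (level_set A \<alpha>) \<longleftrightarrow> is_smallest \<alpha> (range (\<lambda>k. defect A (2 ^ k * n)))"
proof
  have n: "n \<ge> 1" "defect A n = \<alpha>"
    using is_leader_imp_mem[OF assms(2)] by (auto simp: level_set_def)
  {
    assume "infinite (level_set A \<alpha>)"
    then have "level_set A \<alpha> = {n * 2 ^ k | k. True}"
      using assms(2) by (auto simp: is_leader_def)
    then have "defect A (2 ^ k * n) = \<alpha>" for k
      by (auto simp: level_set_def mult.commute)
    then show "is_smallest \<alpha> (range (\<lambda>k. defect A (2 ^ k * n)))"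
      by (auto simp: is_smallest_def)
  }
  assume least: "is_smallest \<alpha> (range (\<lambda>k. defect A (2 ^ k * n)))"
  \<comment> \<open>The sequence already starts at its smallest value, so being non-increasing it is
    constant.\<close>
  have "defect A (n * 2 ^ k) = \<alpha>" for k
  proof (rule antisym)
    show "defect A (n * 2 ^ k) \<le> \<alpha>"
      using decseqD[OF decseq_defect[OF assms(1) n(1)], of 0 k] n(2) by simp
    show "\<alpha> \<le> defect A (n * 2 ^ k)"
      using least by (simp add: is_smallest_def mult.commute)
  qed
  then have "range (\<lambda>k. n * 2 ^ k) \<subseteq> level_set A \<alpha>"
    using n(1) by (auto simp: level_set_def)
  moreover have "inj (\<lambda>k. n * 2 ^ k)"
    using n(1) by (auto simp: inj_on_def)
  ultimately show "infinite (level_set A \<alpha>)"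
    using finite_subset finite_imageD infinite_UNIV_nat by blast
qed

lemma finite_range_defect:
  assumes "admissible A" "n \<ge> 1"
  shows "finite (range (\<lambda>k. defect A (n * 2 ^ k)))"
  using assms
  by (intro finite_range_decseq_Ints[where b = 0] decseq_defect defect_nonneg defect_diff_Ints) auto

text \<open>All \<open>m * 2 ^ k\<close> lie on the doubling sequence of the odd \<open>n\<close>,
  so none has defect below \<open>\<alpha>\<close>; monotonicity forbids a larger one. Constant
  defect means that each doubling costs exactly one step.\<close>

lemma ell_mult_two_power_of_smallest:
  assumes "admissible A" "odd n" "is_smallest \<alpha> (range (\<lambda>k. defect A (n * 2 ^ k)))"
    and "m \<ge> 1" "defect A m = \<alpha>"
  shows "ell A (m * 2 ^ k) = ell A m + k"
proof -
  obtain j where "defect A m = defect A (n * 2 ^ j)"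
    using assms(3,5) by (auto simp: is_smallest_def)
  then obtain i where i: "m = n * 2 ^ i"
    using defect_eq_odd_imp_multiple assms(2,4) by blast
  have "\<alpha> \<le> defect A (n * 2 ^ (i + k))"
    using assms(3) by (simp add: is_smallest_def)
  moreover have "n * 2 ^ (i + k) = m * 2 ^ k"
    by (simp add: i power_add mult.assoc)
  moreover have "defect A (m * 2 ^ k) \<le> defect A m"
    using decseqD[OF decseq_defect[OF assms(1,4)], of 0 k] by simp
  ultimately have "defect A (m * 2 ^ k) = defect A m"
    using assms(5) by simp
  then have "real (ell A (m * 2 ^ k)) = real (ell A m + k)"
    unfolding defect_mult_two_power[OF assms(4)] by (simp add: defect_def)
  then show ?thesis
    using of_nat_eq_iff by blast
qed

theorem theorem1p12:
  fixes A :: "nat list set"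
  assumes "admissible A"
  shows
    "(\<forall>\<alpha> \<in> defect_values A. \<exists>!n. is_leader A \<alpha> n) \<and>
     (\<forall>\<alpha> \<in> defect_values A. \<forall>n. is_leader A \<alpha> n \<longrightarrow>
        (infinite (level_set A \<alpha>) \<longleftrightarrow>
         is_smallest \<alpha> (range (\<lambda>k. defect A (2 ^ k * n))))) \<and>
     (\<forall>n. odd n \<longrightarrow>
        decseq (\<lambda>k. defect A (n * 2 ^ k)) \<and>
        finite (range (\<lambda>k. defect A (n * 2 ^ k))) \<and>
        (\<forall>i j. defect A (n * 2 ^ i) - defect A (n * 2 ^ j) \<in> \<int>) \<and>
        (\<exists>\<alpha>. is_smallest \<alpha> (range (\<lambda>k. defect A (n * 2 ^ k))) \<and>
             (\<forall>m\<ge>1. \<forall>k. defect A m = \<alpha> \<longrightarrow> ell A (m * 2 ^ k) = ell A m + k)))"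
proof (intro conjI ballI allI impI)
  fix \<alpha> assume "\<alpha> \<in> defect_values A"
  then show "\<exists>!n. is_leader A \<alpha> n"
    using is_leader_exists[OF assms] is_leader_unique by blast
next
  fix \<alpha> n assume "is_leader A \<alpha> n"
  then show "infinite (level_set A \<alpha>) \<longleftrightarrow>
      is_smallest \<alpha> (range (\<lambda>k. defect A (2 ^ k * n)))"
    by (rule infinite_level_set_iff[OF assms])
next
  fix n :: nat assume "odd n"
  then have n: "n \<ge> 1"
    by (simp add: odd_pos Suc_leI)
  show "decseq (\<lambda>k. defect A (n * 2 ^ k))"
    by (rule decseq_defect[OF assms n])
  show fin: "finite (range (\<lambda>k. defect A (n * 2 ^ k)))"
    by (rule finite_range_defect[OF assms n])
  show "defect A (n * 2 ^ i) - defect A (n * 2 ^ j) \<in> \<int>" for i j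
    by (rule defect_diff_Ints[OF n])
  \<comment> \<open>Finiteness of the range guarantees that this minimum is attained.\<close>
  define \<alpha> where "\<alpha> = Min (range (\<lambda>k. defect A (n * 2 ^ k)))"
  have least: "is_smallest \<alpha> (range (\<lambda>k. defect A (n * 2 ^ k)))"
    unfolding is_smallest_def \<alpha>_def using Min_in[OF fin] Min_le[OF fin] by blast
  then show "\<exists>\<alpha>. is_smallest \<alpha> (range (\<lambda>k. defect A (n * 2 ^ k))) \<and>
      (\<forall>m\<ge>1. \<forall>k. defect A m = \<alpha> \<longrightarrow> ell A (m * 2 ^ k) = ell A m + k)"
    using ell_mult_two_power_of_smallest[OF assms \<open>odd n\<close> least] by blast
qed

end
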